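(* Let $G$ be a finite simple graph without isolated vertices and with maximum degree $\Delta$. Then every complex root $z$ of the domination polynomial $D(G,z)$ satisfies $|z|\le 2^{\Delta+1}$, and every complex root $z$ of the total domination polynomial $D_t(G,z)$ satisfies $|z|\le 2^{\Delta}$.
   Context: A set $S\subseteq V(G)$ is a dominating set if every $u\in V(G)$ either belongs to $S$ or has a neighbor in $S$; $d_k(G)$ is the number of dominating sets of size $k$, and $D(G,z)=\sum_k d_k(G)z^k$. A set $S\subseteq V(G)$ is a total dominating set if every $u\in V(G)$ has a neighbor in $S$; $d^{(t)}_k(G)$ is the number of total dominating sets of size $k$, and $D_t(G,z)=\sum_k d^{(t)}_k(G)z^k$. *)

theory Defs
  imports
    Complex_Main
    "HOL-Computational_Algebra.Polynomial"
    "Graph_Theory.Digraph"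
begin

text \<open>
  A finite simple graph is an element of the locale \<^locale>\<open>graph\<close>: a finite, loopfree, symmetric
  digraph without parallel arcs. Each edge is a pair of opposite arcs, so two vertices are adjacent
  iff \<open>u \<rightarrow>\<^bsub>G\<^esub> v\<close>, and the degree of a vertex is its \<^const>\<open>out_degree\<close>.
\<close>

definition dominating_set :: "('a, 'b) pre_digraph \<Rightarrow> 'a set \<Rightarrow> bool" where
  "dominating_set G S \<longleftrightarrow>
     S \<subseteq> verts G \<and> (\<forall>u\<in>verts G. u \<in> S \<or> (\<exists>v\<in>S. u \<rightarrow>\<^bsub>G\<^esub> v))"

definition total_dominating_set :: "('a, 'b) pre_digraph \<Rightarrow> 'a set \<Rightarrow> bool" where
  "total_dominating_set G S \<longleftrightarrow>
     S \<subseteq> verts G \<and> (\<forall>u\<in>verts G. \<exists>v\<in>S. u \<rightarrow>\<^bsub>G\<^esub> v)"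

definition num_dominating_sets :: "('a, 'b) pre_digraph \<Rightarrow> nat \<Rightarrow> nat" where
  "num_dominating_sets G k = card {S. dominating_set G S \<and> card S = k}"

definition num_total_dominating_sets :: "('a, 'b) pre_digraph \<Rightarrow> nat \<Rightarrow> nat" where
  "num_total_dominating_sets G k = card {S. total_dominating_set G S \<and> card S = k}"

text \<open>
  The counts vanish for \<open>k > card (verts G)\<close>, so the sums below include every nonzero term.
\<close>

definition domination_poly :: "('a, 'b) pre_digraph \<Rightarrow> complex poly" where
  "domination_poly G = (\<Sum>k\<le>card (verts G). monom (of_nat (num_dominating_sets G k)) k)"

definition total_domination_poly :: "('a, 'b) pre_digraph \<Rightarrow> complex poly" where
  "total_domination_poly G =
     (\<Sum>k\<le>card (verts G). monom (of_nat (num_total_dominating_sets G k)) k)"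

text \<open>The element \<open>0\<close> only matters for the graph without vertices.\<close>

definition max_degree :: "('a, 'b) pre_digraph \<Rightarrow> nat" where
  "max_degree G = Max (insert 0 (out_degree G ` verts G))"

end

theory Submission
  imports Defs
begin

text \<open>
  Both polynomials count hitting sets. A set dominates \<open>G\<close> iff it meets every closed neighbourhood,
  and it dominates totally iff it meets every open neighbourhood. Each vertex lies in at most
  \<open>\<Delta> + 1\<close> closed and at most \<open>\<Delta>\<close> open neighbourhoods, so both bounds are instances of one statement
  about hypergraphs: if all vertex degrees are at most \<open>D\<close> and every edge contains a vertex, then
  the generating polynomial \<open>T V E z\<close> of the hitting sets, \<open>hitting_poly\<close> below, has no root with \<open>\<bar>z\<bar> > 2 ^ D\<close>.

  Splitting by whether a hitting set contains a vertex \<open>v\<close> gives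
  \<open>T V E z = z * T (V - {v}) {e \<in> E. v \<notin> e} z + T (V - {v}) E z\<close>. The two terms on the right have
  the same vertices, and their edge sets differ by the at most \<open>D\<close> edges through \<open>v\<close>. If adding
  an edge multiplies \<open>\<bar>T\<bar>\<close> by at most \<open>2\<close>, then the last term is at most \<open>2 ^ D\<close> times
  the absolute value of \<open>T (V - {v}) {e \<in> E. v \<notin> e} z\<close>, so for \<open>\<bar>z\<bar> > 2 ^ D\<close> the
  first term dominates, and \<open>T V E z = 0\<close> would force the same for the smaller hypergraph with
  vertices \<open>V - {v}\<close> and edges \<open>{e \<in> E. v \<notin> e}\<close> (\<open>hitting_poly_nonzero\<close>). Open neighbourhoods
  contain a vertex because no vertex is isolated.

  The factor \<open>2\<close> holds because adding an edge \<open>f\<close> to \<open>E\<close> subtracts exactly the hitting sets of \<open>E\<close>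
  that avoid \<open>f\<close>, and these contribute \<open>T (V - f) E z\<close>. A vertex of \<open>f\<close> has at most \<open>D - 1\<close> edges
  in \<open>E\<close>, so for \<open>\<bar>z\<bar> \<ge> 2 ^ D\<close> the first term of the splitting formula is at least twice the second,
  and deleting the vertex does not increase \<open>\<bar>T\<bar>\<close>. Deleting all vertices of \<open>f\<close> in turn shows that
  the subtracted quantity is at most \<open>\<bar>T V E z\<bar>\<close>. The two estimates feed each other by induction on
  the vertex set (\<open>hitting_poly_edge_removal\<close>). They are stated without quotients, so it does not
  matter whether intermediate values vanish.
\<close>

section \<open>The hitting set polynomial of a hypergraph\<close>

text \<open>
  Edges need not be contained in \<open>V\<close>; only their traces on \<open>V\<close> matter. So \<open>V - {v}\<close> with the same
  edges stands for the hypergraph in which \<open>v\<close> is removed from every edge.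
\<close>

definition hitting_sets :: "'a set \<Rightarrow> 'a set set \<Rightarrow> 'a set set" where
  "hitting_sets V E = {S. S \<subseteq> V \<and> (\<forall>e\<in>E. S \<inter> e \<noteq> {})}"

definition hitting_poly :: "'a set \<Rightarrow> 'a set set \<Rightarrow> complex \<Rightarrow> complex" where
  "hitting_poly V E z = (\<Sum>S\<in>hitting_sets V E. z ^ card S)"

abbreviation edges_at :: "'a set set \<Rightarrow> 'a \<Rightarrow> 'a set set" where
  "edges_at E v \<equiv> {e\<in>E. v \<in> e}"

lemma finite_hitting_sets [simp]: "finite V \<Longrightarrow> finite (hitting_sets V E)"
  by (rule finite_subset[of _ "Pow V"]) (auto simp: hitting_sets_def)

lemma hitting_poly_split:
  assumes "finite V" "v \<in> V"
  shows "hitting_poly V E z =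
           z * hitting_poly (V - {v}) (E - edges_at E v) z + hitting_poly (V - {v}) E z"
proof -
  let ?A = "hitting_sets (V - {v}) (E - edges_at E v)" and ?B = "hitting_sets (V - {v}) E"
  have split: "hitting_sets V E = insert v ` ?A \<union> ?B"
  proof (intro equalityI subsetI)
    fix S assume S: "S \<in> hitting_sets V E"
    show "S \<in> insert v ` ?A \<union> ?B"
    proof (cases "v \<in> S")
      case True
      then have "S - {v} \<in> ?A" using S by (auto simp: hitting_sets_def)
      moreover have "S = insert v (S - {v})" using True by auto
      ultimately show ?thesis by blast
    next
      case False
      then show ?thesis using S by (auto simp: hitting_sets_def)
    qed
  next
    fix S assume "S \<in> insert v ` ?A \<union> ?B"
    then show "S \<in> hitting_sets V E"
      using assms(2) by (fastforce simp: hitting_sets_def)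
  qed
  have disj: "insert v ` ?A \<inter> ?B = {}"
    by (auto simp: hitting_sets_def)
  have inj: "inj_on (insert v) ?A"
    by (rule inj_onI) (auto simp: hitting_sets_def insert_ident subset_Diff_insert)
  have card: "card (insert v S) = Suc (card S)" if "S \<in> ?A" for S
    using that finite_subset[of S V] assms(1)
    by (subst card_insert_disjoint) (auto simp: hitting_sets_def)
  have "hitting_poly V E z = (\<Sum>S\<in>insert v ` ?A. z ^ card S) + hitting_poly (V - {v}) E z"
    unfolding hitting_poly_def split using assms(1) disj by (subst sum.union_disjoint) auto
  also have "(\<Sum>S\<in>insert v ` ?A. z ^ card S) = (\<Sum>S\<in>?A. z * z ^ card S)"
    by (subst sum.reindex[OF inj]) (auto simp: card intro!: sum.cong)
  finally show ?thesis
    by (simp add: hitting_poly_def sum_distrib_left)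
qed

lemma hitting_poly_insert_edge:
  assumes "finite V"
  shows "hitting_poly V (insert f E) z = hitting_poly V E z - hitting_poly (V - f) E z"
proof -
  have "hitting_sets V E = hitting_sets V (insert f E) \<union> hitting_sets (V - f) E"
    "hitting_sets V (insert f E) \<inter> hitting_sets (V - f) E = {}"
    by (auto simp: hitting_sets_def)
  then have "hitting_poly V E z = hitting_poly V (insert f E) z + hitting_poly (V - f) E z"
    unfolding hitting_poly_def using assms by (simp add: sum.union_disjoint)
  then show ?thesis by simp
qed

section \<open>Comparing hypergraphs on the same vertices\<close>

text \<open>
  Deleting a vertex of degree less than \<open>D\<close> does not increase the absolute value, given the
  comparison of edge sets on the remaining vertices: with \<open>X\<close> the absolute value of the polynomial
  for \<open>V - {u}\<close> and the edges that avoid \<open>u\<close>, the two terms of the splitting formula are at least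
  \<open>2 ^ D * X\<close> and at most \<open>2 ^ (D - 1) * X\<close>.
\<close>

lemma hitting_poly_vertex_removal:
  assumes "finite V" "u \<in> V" "card (edges_at E u) < D" "2 ^ D \<le> cmod z"
    and compare: "cmod (hitting_poly (V - {u}) E z) \<le>
      2 ^ card (edges_at E u) * cmod (hitting_poly (V - {u}) (E - edges_at E u) z)"
  shows "cmod (hitting_poly (V - {u}) E z) \<le> cmod (hitting_poly V E z)"
proof -
  define X where "X = cmod (hitting_poly (V - {u}) (E - edges_at E u) z)"
  define Y where "Y = cmod (hitting_poly (V - {u}) E z)"
  have "(2::real) * 2 ^ card (edges_at E u) = 2 ^ Suc (card (edges_at E u))" by simp
  also have "\<dots> \<le> 2 ^ D" using assms(3) by (intro power_increasing) auto
  also have "\<dots> \<le> cmod z" by fact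
  finally have "2 * 2 ^ card (edges_at E u) * X \<le> cmod z * X"
    by (rule mult_right_mono) (simp add: X_def)
  then have "2 * Y \<le> cmod z * X" using compare by (simp add: X_def Y_def)
  moreover have "cmod z * X - Y \<le> cmod (hitting_poly V E z)"
    unfolding hitting_poly_split[OF assms(1,2), of E z] X_def Y_def norm_mult[symmetric]
    by (rule norm_diff_ineq)
  ultimately show ?thesis by (simp add: Y_def)
qed

text \<open>
  The induction is over all vertex sets because vertex deletion on \<open>W \<subseteq> V\<close> refers to the comparison
  on \<open>W - {u}\<close>.
\<close>

lemma hitting_poly_edge_removal:
  assumes "finite V" "finite E" "F \<subseteq> E" "2 ^ D \<le> cmod z"
    and "\<And>v. v \<in> V \<Longrightarrow> card (edges_at E v) \<le> D"
  shows "cmod (hitting_poly V E z) \<le> 2 ^ card (E - F) * cmod (hitting_poly V F z)"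
  using assms(1-3,5)
proof (induction V arbitrary: E F rule: finite_psubset_induct)
  case (psubset V)
  have vertex: "cmod (hitting_poly (W - {u}) E' z) \<le> cmod (hitting_poly W E' z)"
    if "W \<subseteq> V" "u \<in> W" "finite E'" "card (edges_at E' u) < D"
      "\<And>v. v \<in> V \<Longrightarrow> card (edges_at E' v) \<le> D" for W u E'
  proof (rule hitting_poly_vertex_removal)
    have "cmod (hitting_poly (W - {u}) E' z)
        \<le> 2 ^ card (E' - (E' - edges_at E' u)) * cmod (hitting_poly (W - {u}) (E' - edges_at E' u) z)"
      using that by (intro psubset.IH) auto
    moreover have "E' - (E' - edges_at E' u) = edges_at E' u" by blast
    ultimately show "cmod (hitting_poly (W - {u}) E' z)
        \<le> 2 ^ card (edges_at E' u) * cmod (hitting_poly (W - {u}) (E' - edges_at E' u) z)"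
      by simp
  qed (use that psubset.hyps assms(4) in \<open>auto intro: finite_subset\<close>)
  have vertices: "cmod (hitting_poly (V - A) E' z) \<le> cmod (hitting_poly V E' z)"
    if "finite A" "A \<subseteq> V" "finite E'" "\<And>u. u \<in> A \<Longrightarrow> card (edges_at E' u) < D"
      "\<And>v. v \<in> V \<Longrightarrow> card (edges_at E' v) \<le> D" for A E'
    using that(1,2,4)
  proof (induction A)
    case (insert a A)
    have "cmod (hitting_poly (V - A - {a}) E' z) \<le> cmod (hitting_poly (V - A) E' z)"
      using insert that by (intro vertex) auto
    also have "\<dots> \<le> cmod (hitting_poly V E' z)" using insert by auto
    finally show ?case by (simp flip: Diff_insert)
  qed simp
  have edge: "cmod (hitting_poly V (insert f E') z) \<le> 2 * cmod (hitting_poly V E' z)"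
    if "f \<notin> E'" "finite E'" "\<And>v. v \<in> V \<Longrightarrow> card (edges_at (insert f E') v) \<le> D" for f E'
  proof -
    have le: "card (edges_at E' v) \<le> card (edges_at (insert f E') v)" for v
      using that(2) by (intro card_mono) auto
    have less: "card (edges_at E' v) < card (edges_at (insert f E') v)" if "v \<in> f" for v
      using \<open>finite E'\<close> \<open>f \<notin> E'\<close> that by (intro psubset_card_mono) auto
    have "cmod (hitting_poly (V - V \<inter> f) E' z) \<le> cmod (hitting_poly V E' z)"
    proof (rule vertices)
      show "card (edges_at E' v) \<le> D" if "v \<in> V" for v
        using le[of v] \<open>\<And>v. v \<in> V \<Longrightarrow> card (edges_at (insert f E') v) \<le> D\<close>[OF that] by linarith
      show "card (edges_at E' v) < D" if "v \<in> V \<inter> f" for v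
        using less[of v] \<open>\<And>v. v \<in> V \<Longrightarrow> card (edges_at (insert f E') v) \<le> D\<close>[of v] that by simp
    qed (use psubset.hyps \<open>finite E'\<close> in auto)
    then have "cmod (hitting_poly (V - f) E' z) \<le> cmod (hitting_poly V E' z)"
      by (simp add: Diff_Int)
    then show ?thesis
      unfolding hitting_poly_insert_edge[OF psubset.hyps]
      using norm_triangle_ineq4[of "hitting_poly V E' z" "hitting_poly (V - f) E' z"] by linarith
  qed
  have "cmod (hitting_poly V (F \<union> B) z) \<le> 2 ^ card B * cmod (hitting_poly V F z)"
    if "finite B" "B \<subseteq> E - F" for B
    using that
  proof (induction B)
    case (insert f B)
    have "card (edges_at (insert f (F \<union> B)) v) \<le> D" if "v \<in> V" for v
    proof -
      have "card (edges_at (insert f (F \<union> B)) v) \<le> card (edges_at E v)"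
        using insert.prems psubset.prems by (intro card_mono) auto
      then show ?thesis using psubset.prems(3)[OF that] by simp
    qed
    then have "cmod (hitting_poly V (insert f (F \<union> B)) z) \<le> 2 * cmod (hitting_poly V (F \<union> B) z)"
      using insert psubset.prems by (intro edge) (auto intro: finite_subset)
    also have "\<dots> \<le> 2 * (2 ^ card B * cmod (hitting_poly V F z))"
      using insert by simp
    finally show ?case using insert by simp
  qed simp
  from this[of "E - F"] show ?case
    using psubset.prems(1,2) by (simp add: Un_absorb1)
qed

theorem hitting_poly_nonzero:
  assumes "finite V" "finite E" "2 ^ D < cmod z"
    and "\<And>v. v \<in> V \<Longrightarrow> card (edges_at E v) \<le> D"
    and "\<And>e. e \<in> E \<Longrightarrow> V \<inter> e \<noteq> {}"
  shows "hitting_poly V E z \<noteq> 0"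
  using assms(1,2,4,5)
proof (induction V arbitrary: E rule: finite_psubset_induct)
  case (psubset V)
  show ?case
  proof (cases "V = {}")
    case True
    \<comment> \<open>Every edge meets \<open>V\<close>, so there are no edges, and the empty set is the only hitting set.\<close>
    then have "E = {}" using psubset.prems(3) by auto
    with True have "hitting_sets V E = {{}}" by (auto simp: hitting_sets_def)
    then show ?thesis by (simp add: hitting_poly_def)
  next
    case False
    then obtain v where v: "v \<in> V" by blast
    define E0 where "E0 = E - edges_at E v"
    define T0 where "T0 = hitting_poly (V - {v}) E0 z"
    have "card (edges_at E0 w) \<le> D" if "w \<in> V" for w
    proof -
      have "card (edges_at E0 w) \<le> card (edges_at E w)"
        using psubset.prems(1) by (intro card_mono) (auto simp: E0_def)
      then show ?thesis using psubset.prems(2)[OF that] by simp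
    qed
    then have nz: "T0 \<noteq> 0"
      unfolding T0_def using v psubset.prems(1,3) by (intro psubset.IH) (auto simp: E0_def)
    have "E - E0 = edges_at E v" by (auto simp: E0_def)
    then have "cmod (hitting_poly (V - {v}) E z) \<le> 2 ^ card (edges_at E v) * cmod T0"
      unfolding T0_def
      using hitting_poly_edge_removal[of "V - {v}" E E0 D z] psubset.hyps psubset.prems assms(3)
      by (auto simp: E0_def)
    also have "\<dots> \<le> 2 ^ D * cmod T0"
      using psubset.prems(2)[OF v] by (intro mult_right_mono power_increasing) auto
    also have "\<dots> < cmod z * cmod T0"
      using assms(3) nz by simp
    finally have "cmod (hitting_poly (V - {v}) E z) < cmod (z * T0)"
      by (simp add: norm_mult)
    then have "z * T0 + hitting_poly (V - {v}) E z \<noteq> 0"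
      by (metis add_eq_0_iff less_irrefl norm_minus_cancel)
    then show ?thesis
      by (simp add: hitting_poly_split[OF psubset.hyps v] T0_def E0_def)
  qed
qed

section \<open>Dominating sets as hitting sets of neighbourhoods\<close>

lemma poly_of_size_counts:
  assumes "finite V" "\<And>S. P S \<Longrightarrow> S \<subseteq> V"
  shows "poly (\<Sum>k\<le>card V. monom (of_nat (card {S. P S \<and> card S = k})) k) z
         = (\<Sum>S | P S. z ^ card S :: complex)"
proof -
  have fin: "finite {S. P S}"
    using assms by (auto intro: finite_subset[of _ "Pow V"])
  have "(\<Sum>S | P S. z ^ card S)
      = (\<Sum>k\<le>card V. \<Sum>S | S \<in> {S. P S} \<and> card S = k. z ^ card S)"
    using fin assms by (intro sum.group[symmetric]) (auto intro: card_mono)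
  also have "\<dots> = (\<Sum>k\<le>card V. of_nat (card {S. P S \<and> card S = k}) * z ^ k)"
    by (intro sum.cong) auto
  finally show ?thesis by (simp add: poly_sum poly_monom)
qed

lemma poly_domination_poly:
  assumes "finite (verts G)"
  shows "poly (domination_poly G) z =
    hitting_poly (verts G) ((\<lambda>u. insert u {v. u \<rightarrow>\<^bsub>G\<^esub> v}) ` verts G) z"
proof -
  have "{S. dominating_set G S}
      = hitting_sets (verts G) ((\<lambda>u. insert u {v. u \<rightarrow>\<^bsub>G\<^esub> v}) ` verts G)"
    by (auto simp: dominating_set_def hitting_sets_def disjoint_iff)
  then show ?thesis
    unfolding domination_poly_def num_dominating_sets_def hitting_poly_def
    using poly_of_size_counts[OF assms, of "dominating_set G" z]
    by (simp add: dominating_set_def)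
qed

lemma poly_total_domination_poly:
  assumes "finite (verts G)"
  shows "poly (total_domination_poly G) z =
    hitting_poly (verts G) ((\<lambda>u. {v. u \<rightarrow>\<^bsub>G\<^esub> v}) ` verts G) z"
proof -
  have "{S. total_dominating_set G S}
      = hitting_sets (verts G) ((\<lambda>u. {v. u \<rightarrow>\<^bsub>G\<^esub> v}) ` verts G)"
    by (auto simp: total_dominating_set_def hitting_sets_def disjoint_iff)
  then show ?thesis
    unfolding total_domination_poly_def num_total_dominating_sets_def hitting_poly_def
    using poly_of_size_counts[OF assms, of "total_dominating_set G" z]
    by (simp add: total_dominating_set_def)
qed

lemma (in fin_digraph) neighbourhood_bound:
  assumes "v \<in> verts G"
  shows "finite {u. v \<rightarrow>\<^bsub>G\<^esub> u}" "card {u. v \<rightarrow>\<^bsub>G\<^esub> u} \<le> max_degree G"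
proof -
  have image: "{u. v \<rightarrow>\<^bsub>G\<^esub> u} = head G ` out_arcs G v"
    by (auto simp: arcs_ends_def arc_to_ends_def out_arcs_def image_iff)
  then show "finite {u. v \<rightarrow>\<^bsub>G\<^esub> u}" by (simp add: finite_out_arcs)
  have "card {u. v \<rightarrow>\<^bsub>G\<^esub> u} \<le> out_degree G v"
    unfolding image out_degree_def by (intro card_image_le finite_out_arcs)
  also have "\<dots> \<le> max_degree G"
    unfolding max_degree_def using assms by (intro Max_ge) auto
  finally show "card {u. v \<rightarrow>\<^bsub>G\<^esub> u} \<le> max_degree G" .
qed

text \<open>
  By symmetry of adjacency, the open neighbourhoods that contain \<open>v\<close> are those of the neighbours of
  \<open>v\<close>; the closed ones are those of the neighbours and of \<open>v\<close> itself. Distinct vertices may share a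
  neighbourhood, which only lowers the degree.
\<close>

lemma (in graph) degree_open_neighbourhoods:
  assumes "v \<in> verts G"
  shows "card (edges_at ((\<lambda>u. {w. u \<rightarrow>\<^bsub>G\<^esub> w}) ` verts G) v) \<le> max_degree G"
proof -
  let ?N = "\<lambda>u. {w. u \<rightarrow>\<^bsub>G\<^esub> w}"
  have "edges_at (?N ` verts G) v \<subseteq> ?N ` ?N v"
    by (auto dest: arcs_ends_symmetric[OF sym_arcs])
  then have "card (edges_at (?N ` verts G) v) \<le> card (?N v)"
    using neighbourhood_bound(1)[OF assms] by (rule surj_card_le[rotated])
  with neighbourhood_bound(2)[OF assms] show ?thesis by simp
qed

lemma (in graph) degree_closed_neighbourhoods:
  assumes "v \<in> verts G"
  shows "card (edges_at ((\<lambda>u. insert u {w. u \<rightarrow>\<^bsub>G\<^esub> w}) ` verts G) v) \<le> max_degree G + 1"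
proof -
  let ?N = "\<lambda>u. {w. u \<rightarrow>\<^bsub>G\<^esub> w}"
  let ?C = "\<lambda>u. insert u (?N u)"
  have "edges_at (?C ` verts G) v \<subseteq> ?C ` ?C v"
    by (auto dest: arcs_ends_symmetric[OF sym_arcs])
  then have "card (edges_at (?C ` verts G) v) \<le> card (?C v)"
    using neighbourhood_bound(1)[OF assms] by (intro surj_card_le) auto
  also have "\<dots> \<le> card (?N v) + 1"
    by (simp add: card_insert_le_m1)
  finally show ?thesis using neighbourhood_bound(2)[OF assms] by simp
qed

theorem corollary1p7:
  fixes G :: "('a, 'b) pre_digraph"
  assumes "graph G"
    and no_isolated: "\<forall>u\<in>verts G. \<exists>v\<in>verts G. u \<rightarrow>\<^bsub>G\<^esub> v"
  shows "(\<forall>z. poly (domination_poly G) z = 0 \<longrightarrow> cmod z \<le> 2 ^ (max_degree G + 1)) \<and>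
         (\<forall>z. poly (total_domination_poly G) z = 0 \<longrightarrow> cmod z \<le> 2 ^ max_degree G)"
proof -
  interpret graph G by fact
  have "poly (domination_poly G) z \<noteq> 0" if "2 ^ (max_degree G + 1) < cmod z" for z
    unfolding poly_domination_poly[OF finite_verts]
    using that degree_closed_neighbourhoods
    by (intro hitting_poly_nonzero[where D = "max_degree G + 1"]) auto
  moreover have "poly (total_domination_poly G) z \<noteq> 0" if "2 ^ max_degree G < cmod z" for z
    unfolding poly_total_domination_poly[OF finite_verts]
    using that degree_open_neighbourhoods no_isolated
    by (intro hitting_poly_nonzero[where D = "max_degree G"]) auto
  ultimately show ?thesis by (meson not_le)
qed

end
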